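(* For all positive integers $m,n$, the domination polynomial of the lollipop graph $L_{m,n}$ is unimodal.
   Context: For a finite simple graph $G$ on $n$ vertices, a set $U \subseteq V(G)$ is dominating if every vertex is in $U$ or adjacent to a vertex of $U$; $d_i(G)$ is the number of dominating sets of size $i$ and $D(G,x)=\sum_{i} d_i(G)x^i$ is the domination polynomial. A polynomial is unimodal if its coefficients (ordered by increasing power of $x$) are non-decreasing and then non-increasing. The $(m,n)$-lollipop graph $L_{m,n}$ is the graph on $m+n$ vertices consisting of a complete graph on $m$ vertices and a path on $n$ vertices, with one leaf (endpoint) of the path joined by an edge to a vertex of the complete graph. *)

theory Defs
  imports "HOL-Computational_Algebra.Polynomial" "Graph_Theory.Pair_Digraph"
begin

text \<open>Finite simple graphs are the \<^locale>\<open>pair_graph\<close>s: an edge is a symmetric pair of arcs.\<close>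

definition dominating :: "'a pair_pre_digraph \<Rightarrow> 'a set \<Rightarrow> bool" where
  "dominating G U \<longleftrightarrow>
     U \<subseteq> pverts G \<and> (\<forall>v \<in> pverts G. v \<in> U \<or> (\<exists>u \<in> U. (u, v) \<in> parcs G))"

definition dom_number :: "'a pair_pre_digraph \<Rightarrow> nat \<Rightarrow> nat" where
  "dom_number G i = card {U. dominating G U \<and> card U = i}"

definition domination_poly :: "'a pair_pre_digraph \<Rightarrow> int poly" where
  "domination_poly G = (\<Sum>i \<le> card (pverts G). monom (int (dom_number G i)) i)"

text \<open>Only the coefficients up to the degree are constrained: the zeros beyond it are not part of
  the coefficient sequence.\<close>

definition unimodal :: "'a :: {zero, linorder} poly \<Rightarrow> bool" where
  "unimodal p \<longleftrightarrow>
     (\<exists>k \<le> degree p. mono_on {..k} (coeff p) \<and> antimono_on {k..degree p} (coeff p))"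

text \<open>The vertices \<open>Inl i\<close> form the complete graph, the vertices \<open>Inr j\<close> form the path
  (in the order of the \<open>j\<close>), and its endpoint \<open>Inr 0\<close> is joined to \<open>Inl 0\<close>. This is meant
  for \<open>m, n > 0\<close>.\<close>

definition lollipop :: "nat \<Rightarrow> nat \<Rightarrow> (nat + nat) pair_pre_digraph" where
  "lollipop m n = \<lparr>
     pverts = {..<m} <+> {..<n},
     parcs = {(Inl i, Inl j) | i j. i < m \<and> j < m \<and> i \<noteq> j}
           \<union> {(Inr i, Inr j) | i j. i < n \<and> j < n \<and> (j = Suc i \<or> i = Suc j)}
           \<union> {(Inl 0, Inr 0), (Inr 0, Inl 0)} \<rparr>"

lemma pair_graph_lollipop:
  assumes "m > 0" "n > 0"
  shows "pair_graph (lollipop m n)"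
proof -
  have sub: "parcs (lollipop m n) \<subseteq> pverts (lollipop m n) \<times> pverts (lollipop m n)"
    using assms by (auto simp: lollipop_def)
  have fin: "finite (pverts (lollipop m n))"
    by (simp add: lollipop_def)
  have "finite (parcs (lollipop m n))"
    using finite_subset[OF sub] fin by simp
  moreover have "symmetric (with_proj (lollipop m n))"
    unfolding symmetric_def sym_def by (auto simp: lollipop_def)
  moreover have "fst e \<noteq> snd e" if "e \<in> parcs (lollipop m n)" for e
    using that by (auto simp: lollipop_def)
  ultimately show ?thesis
    using sub fin by unfold_locales auto
qed

lemma card_pverts_lollipop: "card (pverts (lollipop m n)) = m + n"
  by (simp add: lollipop_def card_Plus)

lemma coeff_domination_poly:
  assumes "finite (pverts G)"
  shows "coeff (domination_poly G) i = int (dom_number G i)"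
proof (cases "i \<le> card (pverts G)")
  case True
  then show ?thesis
    by (simp add: domination_poly_def coeff_sum)
next
  case False
  then have "{U. dominating G U \<and> card U = i} = {}"
    using card_mono[OF assms] by (auto simp: dominating_def)
  then have "dom_number G i = 0"
    by (simp only: dom_number_def card.empty)
  with False show ?thesis
    by (simp add: domination_poly_def coeff_sum)
qed

end

theory Submission
  imports Defs
begin

text \<open>
  Let \<open>P\<^sub>n\<close> be the domination polynomial of the path on \<open>n\<close> vertices and \<open>B\<^sub>n\<close> its variant in which
  an endpoint need not be dominated. Splitting on the intersection with the clique gives
  \<open>D(L\<^sub>m\<^sub>,\<^sub>n) = x (1 + x)\<^sup>m\<^sup>-\<^sup>1 B\<^sub>n + ((1 + x)\<^sup>m\<^sup>-\<^sup>1 - 1) P\<^sub>n\<close> for \<open>m \<ge> 2\<close>. This polynomial is even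
  log-concave. Order polynomials by monotone coefficient ratio, \<open>p \<preceq> q\<close> iff
  \<open>p\<^sub>j q\<^sub>i \<le> p\<^sub>i q\<^sub>j\<close> for \<open>i \<le> j\<close>; then log-concavity of \<open>p\<close> means \<open>p \<preceq> x p\<close>, the relation is compatible
  with addition on either side and with multiplication by log-concave polynomials, and it is
  transitive for nonzero polynomials with nonnegative coefficients.
  The coefficient of \<open>x\<^sup>i\<close> in \<open>B\<^sub>n\<close> is the coefficient of \<open>y\<^sup>n\<close> in
  \<open>(1 + y) (y + y\<^sup>2 + y\<^sup>3)\<^sup>i\<close>, and these polynomials in \<open>y\<close> increase with \<open>i\<close>; read in the other
  direction this says \<open>B\<^sub>0 \<preceq> B\<^sub>1 \<preceq> B\<^sub>2 \<preceq> \<dots>\<close>. With the recurrences for \<open>B\<close> and \<open>P\<close> it follows that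
  \<open>P\<^sub>n \<preceq> x B\<^sub>n \<preceq> x P\<^sub>n\<close>, while \<open>e \<preceq> e - 1 \<preceq> x e\<close> for \<open>e = (1 + x)\<^sup>m\<^sup>-\<^sup>1\<close>. These relations make the
  sum of the two products log-concave.
\<close>

section \<open>The ratio order on polynomials\<close>

text \<open>Cross-multiplied form of nondecreasing ratios, meaningful at zeros as well. All pairs
  \<open>i \<le> j\<close> are compared: with zero coefficients, consecutive pairs would say
  less.\<close>

definition ratio_le :: "'a::linordered_idom poly \<Rightarrow> 'a poly \<Rightarrow> bool" (infix "\<preceq>" 50) where
  "p \<preceq> q \<longleftrightarrow> (\<forall>i j. i \<le> j \<longrightarrow> coeff p j * coeff q i \<le> coeff p i * coeff q j)"

definition nonneg_coeffs :: "'a::linordered_idom poly \<Rightarrow> bool" where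
  "nonneg_coeffs p \<longleftrightarrow> (\<forall>i. 0 \<le> coeff p i)"

text \<open>Unlike the condition on three consecutive coefficients alone,
  \<open>p \<preceq> pCons 0 p\<close> also excludes internal zeros.\<close>

definition log_concave :: "'a::linordered_idom poly \<Rightarrow> bool" where
  "log_concave p \<longleftrightarrow> nonneg_coeffs p \<and> p \<preceq> pCons 0 p"

lemma ratio_leD: "p \<preceq> q \<Longrightarrow> i \<le> j \<Longrightarrow> coeff p j * coeff q i \<le> coeff p i * coeff q j"
  by (simp add: ratio_le_def)

lemma nonneg_coeffsD: "nonneg_coeffs p \<Longrightarrow> 0 \<le> coeff p i"
  by (simp add: nonneg_coeffs_def)

lemma nonneg_coeffs_0: "nonneg_coeffs 0"
  by (simp add: nonneg_coeffs_def)

lemma nonneg_coeffs_1: "nonneg_coeffs 1"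
  by (simp add: nonneg_coeffs_def)

lemma nonneg_coeffs_pCons: "0 \<le> a \<Longrightarrow> nonneg_coeffs p \<Longrightarrow> nonneg_coeffs (pCons a p)"
  by (simp add: nonneg_coeffs_def coeff_pCons split: nat.split)

lemma nonneg_coeffs_add: "nonneg_coeffs p \<Longrightarrow> nonneg_coeffs q \<Longrightarrow> nonneg_coeffs (p + q)"
  by (simp add: nonneg_coeffs_def)

lemma nonneg_coeffs_mult: "nonneg_coeffs p \<Longrightarrow> nonneg_coeffs q \<Longrightarrow> nonneg_coeffs (p * q)"
  by (simp add: nonneg_coeffs_def coeff_mult sum_nonneg)

lemmas nonneg_coeffs_intros =
  nonneg_coeffs_0 nonneg_coeffs_1 nonneg_coeffs_pCons nonneg_coeffs_add nonneg_coeffs_mult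

lemma ratio_le_refl: "p \<preceq> p"
  by (simp add: ratio_le_def mult.commute)

lemma ratio_le_add_left: "p \<preceq> r \<Longrightarrow> q \<preceq> r \<Longrightarrow> p + q \<preceq> r"
  by (simp add: ratio_le_def distrib_left distrib_right add_mono)

lemma ratio_le_add_right: "p \<preceq> q \<Longrightarrow> p \<preceq> r \<Longrightarrow> p \<preceq> q + r"
  by (simp add: ratio_le_def distrib_left distrib_right add_mono)

lemma ratio_le_pCons: "p \<preceq> q \<Longrightarrow> pCons 0 p \<preceq> pCons 0 q"
  by (auto simp: ratio_le_def coeff_pCons split: nat.split)

text \<open>Without \<open>q \<noteq> 0\<close> transitivity fails. Isolated zeros of \<open>q\<close> are harmless: if
  \<open>p\<^sub>j r\<^sub>i \<noteq> 0\<close> and one of \<open>q\<^sub>i\<close>, \<open>q\<^sub>j\<close> vanishes, then so does the other, and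
  this forces all of \<open>q\<close> to vanish.\<close>

lemma ratio_le_trans:
  assumes "p \<preceq> q" "q \<preceq> r" "q \<noteq> 0"
    and nn: "nonneg_coeffs p" "nonneg_coeffs q" "nonneg_coeffs r"
  shows "p \<preceq> r"
  unfolding ratio_le_def
proof (intro allI impI)
  fix i j :: nat
  assume ij: "i \<le> j"
  note pos = nn[THEN nonneg_coeffsD]
  show "coeff p j * coeff r i \<le> coeff p i * coeff r j"
  proof (cases "coeff p j = 0 \<or> coeff r i = 0")
    case True
    then show ?thesis using pos by auto
  next
    case False
    with pos have pj: "coeff p j > 0" and ri: "coeff r i > 0"
      by (auto simp: order_less_le)
    have 1: "coeff p j * coeff q i \<le> coeff p i * coeff q j"
      and 2: "coeff q j * coeff r i \<le> coeff q i * coeff r j"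
      using assms ij by (auto dest: ratio_leD)
    show ?thesis
    proof (cases "coeff q i = 0 \<or> coeff q j = 0")
      case True
      have qi: "coeff q i = 0"
        using True 1 pj pos(2)[of i] by (auto simp: mult_le_0_iff)
      have qj: "coeff q j = 0"
        using True 2 ri pos(2)[of j] by (auto simp: mult_le_0_iff)
      have "coeff q k = 0" for k
      proof (cases "k \<le> j")
        case True
        with assms(1) have "coeff p j * coeff q k \<le> coeff p k * coeff q j"
          by (rule ratio_leD)
        then show ?thesis using qj pj pos(2)[of k] by (simp add: mult_le_0_iff)
      next
        case False
        with ij have "i \<le> k" by simp
        with assms(2) have "coeff q k * coeff r i \<le> coeff q i * coeff r k"
          by (rule ratio_leD)
        then show ?thesis using qi ri pos(2)[of k] by (simp add: mult_le_0_iff)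
      qed
      then have "q = 0" by (simp add: poly_eq_iff)
      with \<open>q \<noteq> 0\<close> show ?thesis by simp
    next
      case False
      with pos have qq: "coeff q i * coeff q j > 0"
        by (metis mult_pos_pos order_less_le)
      have "(coeff p j * coeff q i) * (coeff q j * coeff r i)
          \<le> (coeff p i * coeff q j) * (coeff q i * coeff r j)"
        by (intro mult_mono[OF 1 2] mult_nonneg_nonneg pos)
      then have "(coeff q i * coeff q j) * (coeff p j * coeff r i)
          \<le> (coeff q i * coeff q j) * (coeff p i * coeff r j)"
        by (simp add: mult_ac)
      then show ?thesis using qq by (rule mult_left_le_imp_le)
    qed
  qed
qed

section \<open>Shifts and products\<close>

lemma log_concave_nonneg: "log_concave p \<Longrightarrow> nonneg_coeffs p"
  by (simp add: log_concave_def)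

lemma nonneg_coeffs_monom_mult: "nonneg_coeffs p \<Longrightarrow> nonneg_coeffs (monom 1 k * p)"
  by (simp add: nonneg_coeffs_def coeff_monom_mult)

lemma monom_Suc_mult: "monom 1 (Suc k) * p = pCons 0 (monom 1 k * p)"
  by (simp add: monom_Suc)

text \<open>Transitivity along the powers of x. Equivalently, the order-two minors of the Toeplitz
  matrix of \<open>p\<close> are nonnegative. \<open>p = 0\<close> is split off because transitivity
  needs a nonzero middle term.\<close>

lemma log_concave_shift:
  assumes "log_concave p" "k \<le> l"
  shows "monom 1 k * p \<preceq> monom 1 l * p"
  using assms(2)
proof (induction l rule: dec_induct)
  case base
  show ?case by (rule ratio_le_refl)
next
  case (step l)
  have *: "monom 1 l * p \<preceq> monom 1 (Suc l) * p"
  proof (induction l)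
    case 0
    with assms show ?case by (simp add: log_concave_def monom_Suc_mult)
  next
    case (Suc l)
    then show ?case
      unfolding monom_Suc_mult[of "Suc l"] monom_Suc_mult[of l] by (rule ratio_le_pCons)
  qed
  show ?case
  proof (cases "p = 0")
    case True
    then show ?thesis by (simp add: ratio_le_refl)
  next
    case False
    show ?thesis
      by (rule ratio_le_trans[OF step.IH *])
        (use False assms in \<open>simp_all add: nonneg_coeffs_monom_mult log_concave_nonneg\<close>)
  qed
qed

text \<open>The range \<open>N\<close> is independent of \<open>i\<close>, so that coefficients at
  two positions become sums over one index set, as the symmetrisation below requires.\<close>

lemma coeff_mult_sum_shift:
  fixes w p :: "'a::comm_ring_1 poly"
  assumes "i \<le> N"
  shows "coeff (w * p) i = (\<Sum>k\<le>N. coeff p k * coeff (monom 1 k * w) i)"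
proof -
  have "coeff (w * p) i = (\<Sum>k\<le>i. coeff p k * coeff w (i - k))"
    by (subst mult.commute) (simp add: coeff_mult)
  also have "\<dots> = (\<Sum>k\<le>i. coeff p k * coeff (monom 1 k * w) i)"
    by (intro sum.cong) (auto simp: coeff_monom_mult)
  also have "\<dots> = (\<Sum>k\<le>N. coeff p k * coeff (monom 1 k * w) i)"
    using assms by (intro sum.mono_neutral_left) (auto simp: coeff_monom_mult)
  finally show ?thesis .
qed

text \<open>By symmetrisation in the style of Cauchy--Binet, twice the difference of the two sides is a
  sum of products of two minors which have the same sign.\<close>

lemma ratio_le_mult:
  assumes w: "log_concave w" and pq: "p \<preceq> q"
  shows "w * p \<preceq> w * q"
  unfolding ratio_le_def
proof (intro allI impI)
  fix i j :: nat
  assume ij: "i \<le> j"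
  define W where "W k i = coeff (monom 1 k * w) i" for k i
  let ?p = "coeff p" and ?q = "coeff q"
  define F where "F k l = ?p k * ?q l * (W k i * W l j - W k j * W l i)" for k l
  have sum: "coeff (w * r) s = (\<Sum>k\<le>j. coeff r k * W k s)" if "s \<le> j" for r s
    unfolding W_def using that by (rule coeff_mult_sum_shift)
  have "coeff (w * p) i * coeff (w * q) j - coeff (w * p) j * coeff (w * q) i
      = (\<Sum>k\<le>j. \<Sum>l\<le>j. F k l)"
    unfolding sum[OF ij] sum[OF order_refl] sum_product sum_subtractf[symmetric] F_def
    by (intro sum.cong refl) (simp add: algebra_simps)
  moreover have "(\<Sum>k\<le>j. \<Sum>l\<le>j. F k l) \<ge> 0"
  proof -
    have "(\<Sum>k\<le>j. \<Sum>l\<le>j. F k l) = (\<Sum>k\<le>j. \<Sum>l\<le>j. F l k)"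
      by (rule sum.swap)
    then have "2 * (\<Sum>k\<le>j. \<Sum>l\<le>j. F k l) = (\<Sum>k\<le>j. \<Sum>l\<le>j. F k l + F l k)"
      by (simp add: sum.distrib)
    also have "\<dots> \<ge> 0"
    proof (intro sum_nonneg)
      fix k l
      have eq: "F k l + F l k
          = (?p k * ?q l - ?p l * ?q k) * (W k i * W l j - W k j * W l i)"
        by (simp add: F_def algebra_simps)
      have W: "W k j * W l i \<le> W k i * W l j" if "k \<le> l" for k l
        unfolding W_def using log_concave_shift[OF w that] ij by (rule ratio_leD)
      show "0 \<le> F k l + F l k"
      proof (cases "k \<le> l")
        case True
        then show ?thesis
          unfolding eq using ratio_leD[OF pq True] W[OF True] by (intro mult_nonneg_nonneg) auto
      next
        case False
        then have "l \<le> k" by simp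
        then show ?thesis
          unfolding eq using ratio_leD[OF pq \<open>l \<le> k\<close>] W[OF \<open>l \<le> k\<close>]
          by (intro mult_nonpos_nonpos) (auto simp: mult.commute)
      qed
    qed
    finally show ?thesis by simp
  qed
  ultimately show "coeff (w * p) j * coeff (w * q) i \<le> coeff (w * p) i * coeff (w * q) j"
    by simp
qed

section \<open>Closure properties of log-concavity\<close>

lemma log_concave_1: "log_concave 1"
  by (auto simp: log_concave_def ratio_le_def nonneg_coeffs_intros coeff_pCons split: nat.split)

lemma log_concave_pCons: "log_concave p \<Longrightarrow> log_concave (pCons 0 p)"
  by (simp add: log_concave_def nonneg_coeffs_intros ratio_le_pCons)

lemma log_concave_mult:
  assumes "log_concave p" "log_concave q"
  shows "log_concave (p * q)"
  using assms ratio_le_mult[OF assms(1), of q "pCons 0 q"]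
  by (simp add: log_concave_def nonneg_coeffs_intros)

lemma log_concave_power: "log_concave p \<Longrightarrow> log_concave (p ^ n)"
  by (induction n) (simp_all add: log_concave_1 log_concave_mult)

text \<open>Additivity on both sides reduces \<open>p + q \<preceq> x p + x q\<close> to four
  relations; the two mixed ones are assumed.\<close>

lemma log_concave_add:
  assumes "log_concave p" "log_concave q" "p \<preceq> pCons 0 q" "q \<preceq> pCons 0 p"
  shows "log_concave (p + q)"
proof -
  have "p + q \<preceq> pCons 0 p + pCons 0 q"
    using assms by (intro ratio_le_add_left ratio_le_add_right) (simp_all add: log_concave_def)
  then show ?thesis
    using assms by (simp add: log_concave_def nonneg_coeffs_add)
qed

lemma log_concave_1_plus_x: "log_concave [:1, 1:]"
  by (auto simp: log_concave_def ratio_le_def nonneg_coeffs_intros coeff_pCons split: nat.split)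

lemma log_concave_1_plus_x_plus_x2: "log_concave [:1, 1, 1:]"
  by (auto simp: log_concave_def ratio_le_def nonneg_coeffs_intros coeff_pCons split: nat.split)

text \<open>Any position \<open>k\<close> of a maximal coefficient is a mode: compare a step with
  one at \<open>k\<close>, bound the neighbour of \<open>k\<close> by the maximum, and cancel the
  positive coefficient at \<open>k\<close>.\<close>

theorem log_concave_imp_unimodal:
  assumes "log_concave p"
  shows "unimodal p"
proof (cases "p = 0")
  case True
  then show ?thesis
    by (auto simp: unimodal_def monotone_on_def)
next
  case False
  let ?c = "coeff p" and ?d = "degree p"
  have nn: "0 \<le> ?c i" for i
    using assms by (simp add: log_concave_def nonneg_coeffs_def)
  have lc: "?c (Suc j) * ?c i \<le> ?c (Suc i) * ?c j" if "i \<le> j" for i j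
    using ratio_leD[of p "pCons 0 p" "Suc i" "Suc j"] assms that by (simp add: log_concave_def)
  obtain k where k: "k \<le> ?d" "?c k = Max (?c ` {..?d})"
  proof -
    have "Max (?c ` {..?d}) \<in> ?c ` {..?d}"
      by (rule Max_in) auto
    then show thesis using that by (metis imageE atMost_iff)
  qed
  have max: "?c i \<le> ?c k" for i
    using k(2) nn[of k] by (cases "i \<le> ?d") (auto simp: coeff_eq_0)
  have "?c ?d > 0"
    using False nn[of ?d] by (simp add: order_less_le)
  then have ck: "?c k > 0"
    using max[of ?d] by simp
  have inc: "?c i \<le> ?c (Suc i)" if "Suc i \<le> k" for i
  proof -
    from that obtain k' where k': "k = Suc k'" "i \<le> k'"
      by (cases k) auto
    have "?c k * ?c i \<le> ?c (Suc i) * ?c k'"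
      using lc[OF k'(2)] k' by simp
    also have "\<dots> \<le> ?c (Suc i) * ?c k"
      by (intro mult_left_mono max nn)
    finally show ?thesis using ck by (simp add: mult.commute)
  qed
  have dec: "?c (Suc i) \<le> ?c i" if "k \<le> i" for i
  proof -
    have "?c (Suc i) * ?c k \<le> ?c (Suc k) * ?c i"
      by (rule lc[OF that])
    also have "\<dots> \<le> ?c k * ?c i"
      by (intro mult_right_mono max nn)
    finally show ?thesis using ck by (simp add: mult.commute)
  qed
  have "?c i \<le> ?c j" if "i \<le> j" "j \<le> k" for i j
    using that by (induction j rule: dec_induct) (auto intro: order_trans inc)
  moreover have "?c j \<le> ?c i" if "k \<le> i" "i \<le> j" for i j
    using that(2,1) by (induction j rule: dec_induct) (auto intro: order_trans dec)
  ultimately show ?thesis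
    using k(1) unfolding unimodal_def by (intro exI[of _ k]) (auto simp: monotone_on_def)
qed

text \<open>Only the entry at 0 changes, and it falls to 0; at later entries the claims are those
  for \<open>e\<close> itself. Meant for \<open>e = (1 + x)^(m-1)\<close> and
  \<open>h = e - 1\<close>.\<close>

lemma ratio_le_drop_constant:
  fixes e :: "'a::linordered_idom poly"
  assumes "log_concave e"
  defines "h \<equiv> e - [:coeff e 0:]"
  shows "e \<preceq> h" "h \<preceq> pCons 0 e" "log_concave h"
proof -
  have h0: "coeff h 0 = 0" and hS: "coeff h (Suc i) = coeff e (Suc i)" for i
    by (simp_all add: h_def)
  have nn: "0 \<le> coeff e i" for i
    using assms by (simp add: log_concave_def nonneg_coeffs_def)
  have lc: "coeff e (Suc j) * coeff e i \<le> coeff e (Suc i) * coeff e j" if "i \<le> j" for i j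
    using ratio_leD[of e "pCons 0 e" "Suc i" "Suc j"] assms that by (simp add: log_concave_def)
  show "e \<preceq> h"
    unfolding ratio_le_def
  proof (intro allI impI)
    fix i j :: nat
    assume "i \<le> j"
    then show "coeff e j * coeff h i \<le> coeff e i * coeff h j"
      by (cases i; cases j) (simp_all add: h0 hS nn mult.commute)
  qed
  show "h \<preceq> pCons 0 e"
    unfolding ratio_le_def
  proof (intro allI impI)
    fix i j :: nat
    assume "i \<le> j"
    then show "coeff h j * coeff (pCons 0 e) i \<le> coeff h i * coeff (pCons 0 e) j"
      by (cases i; cases j) (simp_all add: h0 hS lc)
  qed
  have "h \<preceq> pCons 0 h"
    unfolding ratio_le_def
  proof (intro allI impI)
    fix i j :: nat
    assume "i \<le> j"
    then show "coeff h j * coeff (pCons 0 h) i \<le> coeff h i * coeff (pCons 0 h) j"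
    proof (cases i; cases j)
      fix i' j' assume "i = Suc i'" "j = Suc j'"
      with \<open>i \<le> j\<close> show ?thesis
        by (cases i'; cases j') (simp_all add: h0 hS nn lc)
    qed (simp_all add: h0 hS nn)
  qed
  moreover have "nonneg_coeffs h"
    unfolding nonneg_coeffs_def
  proof
    fix i show "0 \<le> coeff h i" by (cases i) (simp_all add: h0 hS nn)
  qed
  ultimately show "log_concave h" by (simp add: log_concave_def)
qed

section \<open>Generating polynomials of set families\<close>

definition size_poly :: "'a set set \<Rightarrow> int poly" where
  "size_poly F = (\<Sum>U\<in>F. monom 1 (card U))"

lemma coeff_size_poly:
  assumes "finite F"
  shows "coeff (size_poly F) i = int (card {U \<in> F. card U = i})"
proof -
  have "coeff (size_poly F) i = (\<Sum>U\<in>F. if card U = i then 1 else 0)"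
    by (simp add: size_poly_def coeff_sum)
  also have "\<dots> = int (card {U \<in> F. card U = i})"
    using assms by (simp add: sum.If_cases Int_def)
  finally show ?thesis .
qed

lemma size_poly_Un_disjoint:
  "finite F \<Longrightarrow> finite G \<Longrightarrow> F \<inter> G = {} \<Longrightarrow> size_poly (F \<union> G) = size_poly F + size_poly G"
  by (simp add: size_poly_def sum.union_disjoint)

lemma size_poly_image_card_eq:
  assumes "inj_on f F" "\<And>U. U \<in> F \<Longrightarrow> card (f U) = card U"
  shows "size_poly (f ` F) = size_poly F"
  using assms by (simp add: size_poly_def sum.reindex)

lemma size_poly_image_card_Suc:
  assumes "inj_on f F" "\<And>U. U \<in> F \<Longrightarrow> card (f U) = Suc (card U)"
  shows "size_poly (f ` F) = pCons 0 (size_poly F)"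
proof -
  have "size_poly (f ` F) = (\<Sum>U\<in>F. monom 1 1 * monom 1 (card U))"
    using assms by (simp add: size_poly_def sum.reindex mult_monom)
  also have "\<dots> = monom 1 1 * size_poly F"
    by (simp add: size_poly_def sum_distrib_left)
  finally show ?thesis by (simp add: monom_Suc)
qed

lemma Plus_eq_Plus_iff [simp]: "A <+> C = A' <+> C' \<longleftrightarrow> A = A' \<and> C = C'"
proof -
  have "Inl -` (A <+> C) = A" "Inr -` (A <+> C) = C" for A :: "'a set" and C :: "'b set"
    by auto
  then show ?thesis by metis
qed

lemma size_poly_Plus:
  assumes "\<And>A. A \<in> F \<Longrightarrow> finite A" "\<And>C. C \<in> G \<Longrightarrow> finite C"
  shows "size_poly ((\<lambda>(A, C). A <+> C) ` (F \<times> G)) = size_poly F * size_poly G"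
proof -
  have "inj_on (\<lambda>(A, C). A <+> C) (F \<times> G)"
    by (simp add: inj_on_def)
  then have "size_poly ((\<lambda>(A, C). A <+> C) ` (F \<times> G))
      = (\<Sum>(A, C)\<in>F \<times> G. monom 1 (card (A <+> C)))"
    by (simp add: size_poly_def sum.reindex case_prod_unfold)
  also have "\<dots> = (\<Sum>(A, C)\<in>F \<times> G. monom 1 (card A) * monom 1 (card C))"
    using assms by (intro sum.cong) (auto simp: card_Plus mult_monom)
  also have "\<dots> = size_poly F * size_poly G"
    by (simp add: size_poly_def sum_product sum.cartesian_product)
  finally show ?thesis .
qed

lemma size_poly_insert_Pow:
  assumes "finite S" "a \<notin> S"
  shows "size_poly (insert a ` Pow S) = pCons 0 (size_poly (Pow S))"
  using assms
  by (intro size_poly_image_card_Suc) (auto simp: inj_on_def card_insert_if finite_subset)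

lemma size_poly_Pow:
  assumes "finite S"
  shows "size_poly (Pow S) = [:1, 1:] ^ card S"
  using assms
proof (induction S)
  case empty
  show ?case by (simp add: size_poly_def)
next
  case (insert a S)
  have "size_poly (Pow (insert a S)) = size_poly (Pow S) + size_poly (insert a ` Pow S)"
    unfolding Pow_insert using insert.hyps by (intro size_poly_Un_disjoint) auto
  with insert show ?case
    by (simp add: size_poly_insert_Pow)
qed

section \<open>Dominating sets of paths\<close>

definition path_dom :: "nat set \<Rightarrow> nat \<Rightarrow> bool" where
  "path_dom U v \<longleftrightarrow> v \<in> U \<or> Suc v \<in> U \<or> (\<exists>u \<in> U. v = Suc u)"

definition path_doms :: "nat \<Rightarrow> nat set set" where
  "path_doms n = {U. U \<subseteq> {..<n} \<and> (\<forall>v<n. path_dom U v)}"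

text \<open>Vertex 0 is exempt because it will have a chosen neighbour outside: the clique vertex
  \<open>Inl 0\<close>, or the removed first vertex of a longer path.\<close>

definition rooted_path_doms :: "nat \<Rightarrow> nat set set" where
  "rooted_path_doms n = {U. U \<subseteq> {..<n} \<and> (\<forall>v<n. v = 0 \<or> path_dom U v)}"

definition path_poly :: "nat \<Rightarrow> int poly" where
  "path_poly n = size_poly (path_doms n)"

definition rooted_path_poly :: "nat \<Rightarrow> int poly" where
  "rooted_path_poly n = size_poly (rooted_path_doms n)"

lemma finite_path_doms: "finite (path_doms n)"
  by (rule finite_subset[of _ "Pow {..<n}"]) (auto simp: path_doms_def)

lemma finite_rooted_path_doms: "finite (rooted_path_doms n)"
  by (rule finite_subset[of _ "Pow {..<n}"]) (auto simp: rooted_path_doms_def)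

lemma finite_mem_path_doms: "U \<in> path_doms n \<Longrightarrow> finite U"
  by (auto simp: path_doms_def intro: finite_subset)

lemma finite_mem_rooted_path_doms: "U \<in> rooted_path_doms n \<Longrightarrow> finite U"
  by (auto simp: rooted_path_doms_def intro: finite_subset)

section \<open>Deleting the first vertex of a path\<close>

lemma nat_set_cases:
  obtains (no_zero) V where "U = Suc ` V" | (zero) V where "U = insert 0 (Suc ` V)"
proof -
  let ?V = "{v. Suc v \<in> U}"
  have "x \<in> U \<longleftrightarrow> x \<in> (if 0 \<in> U then insert 0 (Suc ` ?V) else Suc ` ?V)" for x
    by (cases x) auto
  then have "U = (if 0 \<in> U then insert 0 (Suc ` ?V) else Suc ` ?V)"
    by blast
  then show thesis using that by metis
qed

lemma path_dom_Suc_image [simp]: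
  "path_dom (Suc ` V) 0 \<longleftrightarrow> 0 \<in> V"
  "path_dom (Suc ` V) (Suc v) \<longleftrightarrow> path_dom V v"
  by (auto simp: path_dom_def)

lemma path_dom_insert_Suc_image [simp]:
  "path_dom (insert 0 (Suc ` V)) 0"
  "path_dom (insert 0 (Suc ` V)) (Suc v) \<longleftrightarrow> v = 0 \<or> path_dom V v"
  by (auto simp: path_dom_def)

lemma Suc_image_subset_lessThan [simp]: "Suc ` V \<subseteq> {..<Suc n} \<longleftrightarrow> V \<subseteq> {..<n}"
  by auto

text \<open>An unchosen vertex 0 can be dominated only by its right neighbour, which is 0 after the
  shift.\<close>

lemma Suc_image_mem_path_doms:
  "Suc ` V \<in> path_doms (Suc n) \<longleftrightarrow> V \<in> path_doms n \<and> 0 \<in> V"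
  by (auto simp: path_doms_def All_less_Suc2)

text \<open>A chosen vertex 0 dominates its right neighbour, whence the exemption in the shifted
  set.\<close>

lemma insert_mem_path_doms:
  "insert 0 (Suc ` V) \<in> path_doms (Suc n) \<longleftrightarrow> V \<in> rooted_path_doms n"
  by (auto simp: path_doms_def rooted_path_doms_def All_less_Suc2)

lemma Suc_image_mem_rooted_path_doms:
  "Suc ` V \<in> rooted_path_doms (Suc n) \<longleftrightarrow> V \<in> path_doms n"
  by (auto simp: path_doms_def rooted_path_doms_def All_less_Suc2)

lemma insert_mem_rooted_path_doms:
  "insert 0 (Suc ` V) \<in> rooted_path_doms (Suc n) \<longleftrightarrow> V \<in> rooted_path_doms n"
  by (auto simp: rooted_path_doms_def All_less_Suc2)

lemma inj_Suc_image: "inj_on ((`) Suc) F"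
  by (rule inj_onI) (simp add: inj_image_eq_iff)

lemma inj_insert_Suc_image: "inj_on (\<lambda>V. insert 0 (Suc ` V)) F"
proof (rule inj_onI)
  fix V W :: "nat set"
  assume "insert 0 (Suc ` V) = insert 0 (Suc ` W)"
  moreover have "0 \<notin> Suc ` V" "0 \<notin> Suc ` W" by auto
  ultimately have "Suc ` V = Suc ` W" by (metis insert_ident)
  then show "V = W" by (simp add: inj_image_eq_iff)
qed

lemma size_poly_Suc_image: "size_poly ((`) Suc ` F) = size_poly F"
  by (intro size_poly_image_card_eq inj_Suc_image) (simp add: card_image)

lemma size_poly_insert_Suc_image:
  assumes "\<And>V. V \<in> F \<Longrightarrow> finite V"
  shows "size_poly ((\<lambda>V. insert 0 (Suc ` V)) ` F) = pCons 0 (size_poly F)"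
  using assms by (intro size_poly_image_card_Suc inj_insert_Suc_image) (simp add: card_image)

lemma path_doms_with_0:
  "{U \<in> path_doms (Suc n). 0 \<in> U} = (\<lambda>V. insert 0 (Suc ` V)) ` rooted_path_doms n"
proof (intro equalityI subsetI)
  fix U assume "U \<in> {U \<in> path_doms (Suc n). 0 \<in> U}"
  then show "U \<in> (\<lambda>V. insert 0 (Suc ` V)) ` rooted_path_doms n"
    by (cases U rule: nat_set_cases) (auto simp: insert_mem_path_doms)
qed (auto simp: insert_mem_path_doms)

lemma size_poly_path_doms_with_0:
  "size_poly {U \<in> path_doms (Suc n). 0 \<in> U} = pCons 0 (rooted_path_poly n)"
  unfolding path_doms_with_0 rooted_path_poly_def
  by (intro size_poly_insert_Suc_image) (rule finite_mem_rooted_path_doms)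

section \<open>Recurrences for the path polynomials\<close>

lemma rooted_path_poly_0: "rooted_path_poly 0 = 1"
proof -
  have "rooted_path_doms 0 = {{}}" by (auto simp: rooted_path_doms_def)
  then show ?thesis by (simp add: rooted_path_poly_def size_poly_def)
qed

lemma path_poly_0: "path_poly 0 = 1"
proof -
  have "path_doms 0 = {{}}" by (auto simp: path_doms_def)
  then show ?thesis by (simp add: path_poly_def size_poly_def)
qed

lemma rooted_path_poly_Suc:
  "rooted_path_poly (Suc n) = pCons 0 (rooted_path_poly n) + path_poly n"
proof -
  let ?i = "\<lambda>V. insert 0 (Suc ` V)"
  have "rooted_path_doms (Suc n) = ?i ` rooted_path_doms n \<union> (`) Suc ` path_doms n"
  proof (intro equalityI subsetI)
    fix U assume "U \<in> rooted_path_doms (Suc n)"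
    then show "U \<in> ?i ` rooted_path_doms n \<union> (`) Suc ` path_doms n"
      by (cases U rule: nat_set_cases)
        (auto simp: insert_mem_rooted_path_doms Suc_image_mem_rooted_path_doms)
  qed (auto simp: insert_mem_rooted_path_doms Suc_image_mem_rooted_path_doms)
  moreover have "?i ` rooted_path_doms n \<inter> (`) Suc ` path_doms n = {}"
    by auto
  ultimately show ?thesis
    unfolding rooted_path_poly_def path_poly_def
    by (simp add: size_poly_Un_disjoint finite_path_doms finite_rooted_path_doms
        size_poly_Suc_image size_poly_insert_Suc_image finite_mem_rooted_path_doms)
qed

lemma path_poly_Suc:
  "path_poly (Suc n) = pCons 0 (rooted_path_poly n) + size_poly {V \<in> path_doms n. 0 \<in> V}"
proof -
  let ?i = "\<lambda>V. insert 0 (Suc ` V)"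
  have "path_doms (Suc n) = ?i ` rooted_path_doms n \<union> (`) Suc ` {V \<in> path_doms n. 0 \<in> V}"
  proof (intro equalityI subsetI)
    fix U assume "U \<in> path_doms (Suc n)"
    then show "U \<in> ?i ` rooted_path_doms n \<union> (`) Suc ` {V \<in> path_doms n. 0 \<in> V}"
      by (cases U rule: nat_set_cases)
        (auto simp: insert_mem_path_doms Suc_image_mem_path_doms)
  qed (auto simp: insert_mem_path_doms Suc_image_mem_path_doms)
  moreover have "?i ` rooted_path_doms n \<inter> (`) Suc ` {V \<in> path_doms n. 0 \<in> V} = {}"
    by auto
  ultimately show ?thesis
    unfolding rooted_path_poly_def path_poly_def
    by (simp add: size_poly_Un_disjoint finite_path_doms finite_rooted_path_doms
        size_poly_Suc_image size_poly_insert_Suc_image finite_mem_rooted_path_doms)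
qed

lemma path_poly_1: "path_poly (Suc 0) = pCons 0 1"
proof -
  have "{V \<in> path_doms 0. 0 \<in> V} = {}" by (auto simp: path_doms_def)
  then show ?thesis
    unfolding path_poly_Suc by (simp only: size_poly_def sum.empty rooted_path_poly_0 add_0_right)
qed

text \<open>If vertex 0 is absent, vertex 1 is forced. Either way the chosen vertex gives a factor x
  and exempts its right neighbour.\<close>

lemma path_poly_Suc_Suc:
  "path_poly (Suc (Suc n)) = pCons 0 (rooted_path_poly (Suc n) + rooted_path_poly n)"
  by (simp add: path_poly_Suc[of "Suc n"] size_poly_path_doms_with_0)

lemma rooted_path_poly_1: "rooted_path_poly (Suc 0) = [:1, 1:]"
  by (simp add: rooted_path_poly_Suc rooted_path_poly_0 path_poly_0 one_pCons)

lemma rooted_path_poly_2: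
  "rooted_path_poly (Suc (Suc 0)) = pCons 0 (rooted_path_poly (Suc 0) + rooted_path_poly 0)"
  by (simp add: rooted_path_poly_Suc[of "Suc 0"] path_poly_1 rooted_path_poly_0)

lemma nat_cases_3:
  obtains "n = 0" | "n = Suc 0" | "n = Suc (Suc 0)" | k where "n = Suc (Suc (Suc k))"
  using that by (metis not0_implies_Suc)

text \<open>One factor x, with the length dropping by 1, 2 or 3: the source of
  \<open>y + y^2 + y^3\<close> in \<open>column_poly\<close>.\<close>

lemma rooted_path_poly_3:
  "rooted_path_poly (Suc (Suc (Suc n))) =
     pCons 0 (rooted_path_poly (Suc (Suc n)) + rooted_path_poly (Suc n) + rooted_path_poly n)"
  by (simp add: rooted_path_poly_Suc[of "Suc (Suc n)"] path_poly_Suc_Suc add.assoc)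

section \<open>Log-concavity of the path polynomials\<close>

text \<open>Here the variable marks the path length and \<open>i\<close> the set size: a column of
  the array whose rows are the \<open>rooted_path_poly n\<close>.\<close>

definition column_poly :: "nat \<Rightarrow> int poly" where
  "column_poly i = [:0, 1, 1, 1:] ^ i * [:1, 1:]"

lemma column_poly_Suc:
  "column_poly (Suc i) = monom 1 1 * column_poly i + monom 1 2 * column_poly i
     + monom 1 3 * column_poly i"
proof -
  have "[:0, 1, 1, 1:] = monom 1 1 + monom 1 2 + (monom 1 3 :: int poly)"
    by (simp add: monom_altdef numeral_eq_Suc)
  then have "column_poly (Suc i) = (monom 1 1 + monom 1 2 + monom 1 3) * column_poly i"
    by (simp only: column_poly_def power_Suc mult.assoc)
  then show ?thesis by (simp add: distrib_right)
qed

text \<open>The recurrence amounts to multiplication by \<open>y + y^2 + y^3\<close>. The factor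
  \<open>1 + y\<close> records that only lengths 0 and 1 admit the empty set.\<close>

lemma coeff_rooted_path_poly: "coeff (rooted_path_poly n) i = coeff (column_poly i) n"
proof (induction i arbitrary: n)
  case 0
  show ?case
    by (cases n rule: nat_cases_3)
      (simp_all add: column_poly_def rooted_path_poly_0 rooted_path_poly_1
        rooted_path_poly_2 rooted_path_poly_3)
next
  case (Suc i)
  show ?case
  proof (cases n rule: nat_cases_3)
    case 1
    then show ?thesis by (simp add: column_poly_Suc coeff_monom_mult rooted_path_poly_0)
  next
    case 2
    have "coeff (rooted_path_poly n) (Suc i) = coeff (rooted_path_poly 0) i"
      by (simp add: 2 rooted_path_poly_0 rooted_path_poly_1 one_pCons)
    then show ?thesis by (simp add: 2 column_poly_Suc coeff_monom_mult Suc)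
  next
    case 3
    have "coeff (rooted_path_poly n) (Suc i)
        = coeff (rooted_path_poly (Suc 0)) i + coeff (rooted_path_poly 0) i"
      by (simp add: 3 rooted_path_poly_2)
    then show ?thesis by (simp add: 3 column_poly_Suc coeff_monom_mult Suc)
  next
    case (4 k)
    then show ?thesis
      by (simp add: column_poly_Suc coeff_monom_mult rooted_path_poly_3 Suc numeral_eq_Suc)
  qed
qed

lemma log_concave_column_poly: "log_concave (column_poly i)"
  unfolding column_poly_def
  by (intro log_concave_mult log_concave_power log_concave_pCons
      log_concave_1_plus_x log_concave_1_plus_x_plus_x2)

lemma column_poly_ne_0: "column_poly i \<noteq> 0"
  unfolding column_poly_def by (metis mult_eq_0_iff pCons_eq_0_iff power_not_zero zero_neq_one)

text \<open>The next column is a sum of shifts of the current one, each above it by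
  log-concavity.\<close>

lemma column_poly_mono: "i \<le> j \<Longrightarrow> column_poly i \<preceq> column_poly j"
proof (induction j rule: dec_induct)
  case base
  show ?case by (rule ratio_le_refl)
next
  case (step j)
  have "column_poly j \<preceq> monom 1 k * column_poly j" for k
    using log_concave_shift[OF log_concave_column_poly, of 0 k] by simp
  then have *: "column_poly j \<preceq> column_poly (Suc j)"
    unfolding column_poly_Suc by (intro ratio_le_add_right)
  show ?case
    by (rule ratio_le_trans[OF step.IH *])
      (auto intro: log_concave_nonneg log_concave_column_poly simp: column_poly_ne_0)
qed

text \<open>Transposition: rows \<open>k \<le> n\<close> at sizes \<open>i \<le> j\<close> obey the
  same two-by-two inequality as columns \<open>i \<le> j\<close> at lengths
  \<open>k \<le> n\<close>.\<close>

lemma rooted_path_poly_mono: "k \<le> n \<Longrightarrow> rooted_path_poly k \<preceq> rooted_path_poly n"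
  using column_poly_mono unfolding ratio_le_def coeff_rooted_path_poly by (metis mult.commute)

lemma nonneg_rooted_path_poly: "nonneg_coeffs (rooted_path_poly n)"
  unfolding nonneg_coeffs_def rooted_path_poly_def
  by (simp add: coeff_size_poly finite_rooted_path_doms)

lemma rooted_path_poly_ne_0: "rooted_path_poly n \<noteq> 0"
proof -
  have "{..<n} \<in> {U \<in> rooted_path_doms n. card U = n}"
    by (auto simp: rooted_path_doms_def path_dom_def)
  then have "card {U \<in> rooted_path_doms n. card U = n} \<noteq> 0"
    using finite_rooted_path_doms[of n] by (auto simp: card_eq_0_iff)
  then have "coeff (rooted_path_poly n) n \<noteq> 0"
    by (simp add: rooted_path_poly_def coeff_size_poly finite_rooted_path_doms)
  then show ?thesis by auto
qed

text \<open>For \<open>n > 0\<close> the left side is x times a sum of polynomials of index at most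
  \<open>n\<close>, each below \<open>rooted_path_poly n\<close> by monotonicity.\<close>

lemma rooted_path_poly_Suc_le: "rooted_path_poly (Suc n) \<preceq> pCons 0 (rooted_path_poly n)"
proof -
  consider "n = 0" | "n = Suc 0" | k where "n = Suc (Suc k)"
    by (metis not0_implies_Suc)
  then show ?thesis
  proof cases
    \<comment> \<open>The one case where the left side is not divisible by x:
      \<open>1 + x \<preceq> x\<close> is checked directly.\<close>
    case 1
    show ?thesis
      unfolding 1 rooted_path_poly_0 rooted_path_poly_1
      by (auto simp: ratio_le_def coeff_pCons split: nat.split)
  next
    case 2
    then show ?thesis
      unfolding 2 rooted_path_poly_2
      by (intro ratio_le_pCons ratio_le_add_left rooted_path_poly_mono) auto
  next
    case 3
    show ?thesis
      unfolding 3 rooted_path_poly_3[of k]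
      by (intro ratio_le_pCons ratio_le_add_left rooted_path_poly_mono) auto
  qed
qed

lemma log_concave_rooted_path_poly: "log_concave (rooted_path_poly n)"
proof (cases n)
  case 0
  then show ?thesis by (simp add: rooted_path_poly_0 log_concave_1)
next
  case (Suc k)
  have "rooted_path_poly n \<preceq> pCons 0 (rooted_path_poly k)"
    unfolding Suc by (rule rooted_path_poly_Suc_le)
  moreover have "pCons 0 (rooted_path_poly k) \<preceq> pCons 0 (rooted_path_poly n)"
    by (intro ratio_le_pCons rooted_path_poly_mono) (simp add: Suc)
  ultimately have "rooted_path_poly n \<preceq> pCons 0 (rooted_path_poly n)"
    by (rule ratio_le_trans)
      (auto simp: rooted_path_poly_ne_0 nonneg_rooted_path_poly nonneg_coeffs_intros)
  then show ?thesis
    by (simp add: log_concave_def nonneg_rooted_path_poly)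
qed

lemma log_concave_path_poly: "log_concave (path_poly n)"
proof -
  consider "n = 0" | "n = Suc 0" | k where "n = Suc (Suc k)"
    by (metis not0_implies_Suc)
  then show ?thesis
  proof cases
    case 3
    \<comment> \<open>One mixed relation for \<open>log_concave_add\<close>; the other is
      \<open>rooted_path_poly_Suc_le\<close>.\<close>
    have "rooted_path_poly k \<preceq> pCons 0 (rooted_path_poly (Suc k))"
    proof (rule ratio_le_trans)
      show "rooted_path_poly k \<preceq> rooted_path_poly (Suc k)"
        by (rule rooted_path_poly_mono) simp
      show "rooted_path_poly (Suc k) \<preceq> pCons 0 (rooted_path_poly (Suc k))"
        using log_concave_rooted_path_poly by (simp add: log_concave_def)
    qed (auto simp: rooted_path_poly_ne_0 nonneg_rooted_path_poly nonneg_coeffs_intros)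
    then show ?thesis
      unfolding 3 path_poly_Suc_Suc
      by (intro log_concave_pCons log_concave_add log_concave_rooted_path_poly
          rooted_path_poly_Suc_le)
  qed (simp_all add: path_poly_0 path_poly_1 log_concave_1 log_concave_pCons)
qed

section \<open>Comparison of the two path polynomials\<close>

lemma path_poly_le: "path_poly n \<preceq> pCons 0 (rooted_path_poly n)"
proof -
  consider "n = 0" | "n = Suc 0" | k where "n = Suc (Suc k)"
    by (metis not0_implies_Suc)
  then show ?thesis
  proof cases
    case 1
    then show ?thesis
      using log_concave_1[where 'a = int] by (simp add: path_poly_0 rooted_path_poly_0 log_concave_def)
  next
    case 2
    have "1 \<preceq> rooted_path_poly (Suc 0)"
      using rooted_path_poly_mono[of 0 "Suc 0"] by (simp add: rooted_path_poly_0)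
    with 2 show ?thesis
      by (simp add: path_poly_1 ratio_le_pCons)
  next
    case 3
    then show ?thesis
      by (simp only: path_poly_Suc_Suc)
        (intro ratio_le_pCons ratio_le_add_left rooted_path_poly_mono; simp)
  qed
qed

text \<open>For \<open>n \<ge> 3\<close>, the sets leaving vertex 0 undominated omit 0 and 1 and
  contain 2. They contribute \<open>x B_(n-3)\<close>, which lies below
  \<open>path_poly n\<close>.\<close>

lemma rooted_path_poly_le: "rooted_path_poly n \<preceq> path_poly n"
proof -
  show ?thesis
  proof (cases n rule: nat_cases_3)
    case 1
    then show ?thesis by (simp add: path_poly_0 rooted_path_poly_0 ratio_le_refl)
  next
    case 2
    then show ?thesis
      using rooted_path_poly_Suc_le[of 0] by (simp add: path_poly_1 rooted_path_poly_0)
  next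
    case 3
    then show ?thesis by (simp add: path_poly_Suc_Suc rooted_path_poly_2 ratio_le_refl)
  next
    case (4 k)
    have "rooted_path_poly n = path_poly n + pCons 0 (rooted_path_poly k)"
      by (simp add: 4 path_poly_Suc_Suc rooted_path_poly_3)
    moreover have "pCons 0 (rooted_path_poly k) \<preceq> path_poly n"
      unfolding 4 path_poly_Suc_Suc
      by (intro ratio_le_pCons ratio_le_add_right rooted_path_poly_mono) auto
    ultimately show ?thesis by (simp add: ratio_le_add_left ratio_le_refl)
  qed
qed

section \<open>The lollipop graph\<close>

lemma bex_Plus_iff: "(\<exists>x \<in> A <+> C. Q x) \<longleftrightarrow> (\<exists>a \<in> A. Q (Inl a)) \<or> (\<exists>c \<in> C. Q (Inr c))"
  by auto

lemma domination_poly_eq_size_poly: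
  assumes "finite (pverts G)"
  shows "domination_poly G = size_poly {U. dominating G U}"
proof (rule poly_eqI)
  fix i
  have "finite {U. dominating G U}"
    by (rule finite_subset[of _ "Pow (pverts G)"]) (auto simp: dominating_def assms)
  then show "coeff (domination_poly G) i = coeff (size_poly {U. dominating G U}) i"
    using assms by (simp add: coeff_domination_poly coeff_size_poly dom_number_def)
qed

text \<open>One chosen clique vertex dominates the whole clique, and the path meets the clique only
  at \<open>Inl 0\<close>. With no clique vertex chosen, the path can dominate only
  \<open>Inl 0\<close>, which is enough just for \<open>m = 1\<close>.\<close>

lemma dominating_lollipop_iff:
  assumes "m > 0" "n > 0"
  shows "dominating (lollipop m n) (A <+> C) \<longleftrightarrow> A \<subseteq> {..<m} \<and>
    (if 0 \<in> A then C \<in> rooted_path_doms n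
     else C \<in> path_doms n \<and> (A \<noteq> {} \<or> m = 1 \<and> 0 \<in> C))"
    (is "?L \<longleftrightarrow> ?R")
proof -
  have clique: "(\<forall>i<m. Inl i \<in> A <+> C \<or> (\<exists>u \<in> A <+> C. (u, Inl i) \<in> parcs (lollipop m n)))
      \<longleftrightarrow> A \<noteq> {} \<or> m = 1 \<and> 0 \<in> C" (is "?l \<longleftrightarrow> ?r") if A: "A \<subseteq> {..<m}"
  proof
    assume ?l
    show ?r
    proof (rule ccontr)
      assume r: "\<not> ?r"
      then have e: "A = {}" by simp
      have "0 \<in> C" using \<open>?l\<close> assms(1) by (auto simp: e lollipop_def)
      with r assms(1) have "m > 1" by simp
      \<comment> \<open>The vertex \<open>Inl 1\<close> has only clique neighbours, none of them
        chosen.\<close>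
      then show False using \<open>?l\<close> by (auto simp: e lollipop_def)
    qed
  next
    assume ?r
    then show ?l
    proof
      assume "A \<noteq> {}"
      then obtain a where "a \<in> A" by auto
      with A show ?l
        by (auto simp: lollipop_def intro!: bexI[of _ "Inl a"])
    next
      assume "m = 1 \<and> 0 \<in> C"
      then show ?l by (auto simp: lollipop_def intro!: bexI[of _ "Inr 0"])
    qed
  qed
  have path: "(\<forall>j<n. Inr j \<in> A <+> C \<or> (\<exists>u \<in> A <+> C. (u, Inr j) \<in> parcs (lollipop m n)))
      \<longleftrightarrow> (\<forall>j<n. path_dom C j \<or> 0 \<in> A \<and> j = 0)" if C: "C \<subseteq> {..<n}"
  proof -
    have "(\<exists>u \<in> A <+> C. (u, Inr j) \<in> parcs (lollipop m n))
        \<longleftrightarrow> Suc j \<in> C \<or> (\<exists>u \<in> C. j = Suc u) \<or> 0 \<in> A \<and> j = 0" if "j < n" for j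
    proof -
      have "(Inl a, Inr j) \<in> parcs (lollipop m n) \<longleftrightarrow> a = 0 \<and> j = 0" for a
        by (auto simp: lollipop_def)
      moreover have "(Inr u, Inr j) \<in> parcs (lollipop m n) \<longleftrightarrow> u < n \<and> (j = Suc u \<or> u = Suc j)" for u
        using that by (auto simp: lollipop_def)
      ultimately show ?thesis
        using C by (auto simp: bex_Plus_iff)
    qed
    then show ?thesis by (auto simp: path_dom_def)
  qed
  have "?L \<longleftrightarrow> A \<subseteq> {..<m} \<and> C \<subseteq> {..<n} \<and>
      (A \<noteq> {} \<or> m = 1 \<and> 0 \<in> C) \<and> (\<forall>j<n. path_dom C j \<or> 0 \<in> A \<and> j = 0)"
  proof -
    have sub: "A <+> C \<subseteq> {..<m} <+> {..<n} \<longleftrightarrow> A \<subseteq> {..<m} \<and> C \<subseteq> {..<n}"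
      by (auto simp: subset_iff)
    have ball: "(\<forall>v \<in> {..<m} <+> {..<n}. Q v) \<longleftrightarrow> (\<forall>i<m. Q (Inl i)) \<and> (\<forall>j<n. Q (Inr j))"
      for Q :: "nat + nat \<Rightarrow> bool" by auto
    have verts: "pverts (lollipop m n) = {..<m} <+> {..<n}"
      by (simp add: lollipop_def)
    show ?thesis
      unfolding dominating_def verts sub ball using clique path by blast
  qed
  also have "\<dots> \<longleftrightarrow> ?R"
    by (auto simp: path_doms_def rooted_path_doms_def)
  finally show ?thesis .
qed

lemma set_Plus_cases:
  obtains A C where "U = A <+> C"
proof
  show "U = {a. Inl a \<in> U} <+> {c. Inr c \<in> U}"
    by (auto simp: Plus_def image_iff) (metis sumE)
qed

text \<open>The graph is a path with \<open>Inl 0\<close> in front. The family \<open>?T\<close>,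
  where \<open>Inr 0\<close> dominates the whole clique, has no counterpart for
  \<open>m > 1\<close>.\<close>

lemma domination_poly_lollipop_1:
  assumes "n > 0"
  shows "domination_poly (lollipop 1 n) = path_poly (Suc n)"
proof -
  let ?j = "\<lambda>(A, C). A <+> C"
  let ?S = "?j ` ({{0 :: nat}} \<times> rooted_path_doms n)"
  let ?T = "?j ` ({{} :: nat set} \<times> {C \<in> path_doms n. 0 \<in> C})"
  have "{U. dominating (lollipop 1 n) U} = ?S \<union> ?T"
  proof (intro equalityI subsetI)
    fix U assume "U \<in> {U. dominating (lollipop 1 n) U}"
    moreover obtain A C where U: "U = A <+> C"
      by (rule set_Plus_cases)
    ultimately show "U \<in> ?S \<union> ?T"
      using assms by (auto simp: dominating_lollipop_iff lessThan_Suc subset_singleton_iff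
          split: if_splits)
  qed (use assms in \<open>auto simp: dominating_lollipop_iff\<close>)
  moreover have "?S \<inter> ?T = {}" by auto
  moreover have "finite ?S" "finite ?T"
    by (simp_all add: finite_path_doms finite_rooted_path_doms)
  moreover have "size_poly ?S = pCons 0 (rooted_path_poly n)"
    by (subst size_poly_Plus)
      (auto intro: finite_mem_rooted_path_doms simp: size_poly_def rooted_path_poly_def monom_Suc)
  moreover have "size_poly ?T = size_poly {C \<in> path_doms n. 0 \<in> C}"
    by (subst size_poly_Plus) (auto intro: finite_mem_path_doms simp: size_poly_def)
  moreover have "finite (pverts (lollipop 1 n))" by (simp add: lollipop_def)
  ultimately show ?thesis
    by (simp only: domination_poly_eq_size_poly size_poly_Un_disjoint path_poly_Suc)
qed

text \<open>The factor x due to \<open>Inl 0\<close> is put on the path side, since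
  \<open>path_poly n\<close> compares with x times \<open>rooted_path_poly n\<close>.\<close>

lemma domination_poly_lollipop:
  assumes "m > 1" "n > 0"
  shows "domination_poly (lollipop m n) =
    [:1, 1:] ^ (m - 1) * pCons 0 (rooted_path_poly n) + ([:1, 1:] ^ (m - 1) - 1) * path_poly n"
proof -
  let ?j = "\<lambda>(A, C). A <+> C"
  \<comment> \<open>Clique parts: those in \<open>?F\<close> contain the attaching vertex and exempt
    the first path vertex; those in \<open>?G\<close> dominate the clique but leave the path to
    itself.\<close>
  let ?F = "insert 0 ` Pow {1..<m}" and ?G = "Pow {1..<m} - {{}}"
  let ?S = "?j ` (?F \<times> rooted_path_doms n)"
  let ?T = "?j ` (?G \<times> path_doms n)"
  have F: "A \<in> ?F \<longleftrightarrow> A \<subseteq> {..<m} \<and> 0 \<in> A" for A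
  proof
    assume "A \<subseteq> {..<m} \<and> 0 \<in> A"
    then have "A = insert 0 (A - {0})" "A - {0} \<in> Pow {1..<m}"
      by auto
    then show "A \<in> ?F" by (rule image_eqI)
  qed (use assms in auto)
  have G: "A \<in> ?G \<longleftrightarrow> A \<subseteq> {..<m} \<and> 0 \<notin> A \<and> A \<noteq> {}" for A
  proof -
    have "{1..<m} = {..<m} - {0}" by auto
    then show ?thesis by blast
  qed
  have "{U. dominating (lollipop m n) U} = ?S \<union> ?T"
  proof (intro equalityI subsetI)
    fix U assume "U \<in> {U. dominating (lollipop m n) U}"
    moreover obtain A C where U: "U = A <+> C"
      by (rule set_Plus_cases)
    ultimately have "(A, C) \<in> ?F \<times> rooted_path_doms n \<union> ?G \<times> path_doms n"
      using assms unfolding Un_iff mem_Sigma_iff F G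
      by (auto simp: dominating_lollipop_iff split: if_splits)
    then show "U \<in> ?S \<union> ?T" using U by blast
  next
    fix U assume "U \<in> ?S \<union> ?T"
    then have "U \<in> ?j ` (?F \<times> rooted_path_doms n \<union> ?G \<times> path_doms n)"
      by (simp only: image_Un)
    then obtain p where p: "U = ?j p" "p \<in> ?F \<times> rooted_path_doms n \<union> ?G \<times> path_doms n"
      by (rule imageE)
    obtain A C where AC: "p = (A, C)"
      by (rule prod.exhaust)
    with p(1) have U: "U = A <+> C"
      by (simp only: prod.case)
    from p(2) have "(A, C) \<in> ?F \<times> rooted_path_doms n \<union> ?G \<times> path_doms n"
      unfolding AC .
    then show "U \<in> {U. dominating (lollipop m n) U}"
      using assms unfolding Un_iff mem_Sigma_iff F G by (auto simp: U dominating_lollipop_iff)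
  qed
  moreover have "?S \<inter> ?T = {}"
    by auto
  moreover have "finite ?S" "finite ?T"
    by (simp_all add: finite_path_doms finite_rooted_path_doms)
  moreover have "size_poly ?S = [:1, 1:] ^ (m - 1) * pCons 0 (rooted_path_poly n)"
  proof -
    have "size_poly ?S = size_poly ?F * size_poly (rooted_path_doms n)"
      by (rule size_poly_Plus) (auto intro: finite_mem_rooted_path_doms finite_subset)
    then show ?thesis
      by (simp add: size_poly_insert_Pow size_poly_Pow rooted_path_poly_def)
  qed
  moreover have "size_poly ?T = ([:1, 1:] ^ (m - 1) - 1) * path_poly n"
  proof -
    have "size_poly ?T = size_poly ?G * size_poly (path_doms n)"
      by (rule size_poly_Plus) (auto intro: finite_mem_path_doms finite_subset)
    moreover have "size_poly ?G = size_poly (Pow {1..<m}) - 1"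
      by (simp add: size_poly_def sum_diff)
    ultimately show ?thesis
      by (simp add: size_poly_Pow path_poly_def)
  qed
  moreover have "finite (pverts (lollipop m n))" by (simp add: lollipop_def)
  ultimately show ?thesis
    by (simp only: domination_poly_eq_size_poly size_poly_Un_disjoint)
qed

theorem log_concave_domination_poly_lollipop:
  assumes "m > 0" "n > 0"
  shows "log_concave (domination_poly (lollipop m n))"
proof (cases "m = 1")
  case True
  with assms show ?thesis
    by (simp only: domination_poly_lollipop_1 log_concave_path_poly)
next
  case False
  with assms have m: "m > 1" by simp
  define e :: "int poly" where "e = [:1, 1:] ^ (m - 1)"
  define h where "h = e - 1"
  define a where "a = pCons 0 (rooted_path_poly n)"
  define b where "b = path_poly n"
  have e: "log_concave e"
    unfolding e_def by (intro log_concave_power log_concave_1_plus_x)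
  have "coeff e 0 = 1" by (simp add: e_def coeff_0_power)
  then have "h = e - [:coeff e 0:]" by (simp add: h_def one_pCons)
  with ratio_le_drop_constant[OF e]
  have eh: "e \<preceq> h" "h \<preceq> pCons 0 e" and h: "log_concave h" by simp_all
  have a: "log_concave a" and b: "log_concave b"
    by (simp_all add: a_def b_def log_concave_rooted_path_poly log_concave_path_poly
        log_concave_pCons)
  have ab: "b \<preceq> a" "a \<preceq> pCons 0 b"
    by (simp_all add: a_def b_def path_poly_le rooted_path_poly_le ratio_le_pCons)
  note nn = e[THEN log_concave_nonneg] h[THEN log_concave_nonneg]
    a[THEN log_concave_nonneg] b[THEN log_concave_nonneg]
  have "a \<noteq> 0" by (simp add: a_def rooted_path_poly_ne_0)
  have "e \<noteq> 0" by (simp add: e_def)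
  \<comment> \<open>Here \<open>m > 1\<close> enters: \<open>h * a\<close> must be nonzero to be the
    middle term of both chains below.\<close>
  have "h \<noteq> 0"
  proof
    assume "h = 0"
    then have "degree e = 0" by (simp add: h_def)
    then show False using m by (simp add: e_def degree_power_eq)
  qed
  \<comment> \<open>First exchange \<open>e\<close> for \<open>h\<close>, then \<open>a\<close> for
    x times \<open>b\<close>.\<close>
  have 1: "e * a \<preceq> pCons 0 (h * b)"
  proof (rule ratio_le_trans)
    show "e * a \<preceq> h * a"
      using ratio_le_mult[OF a eh(1)] by (simp add: mult.commute)
    show "h * a \<preceq> pCons 0 (h * b)"
      using ratio_le_mult[OF h ab(2)] by simp
  qed (use \<open>h \<noteq> 0\<close> \<open>a \<noteq> 0\<close> nn in \<open>auto intro!: nonneg_coeffs_intros\<close>)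
  \<comment> \<open>First exchange \<open>b\<close> for \<open>a\<close>, then \<open>h\<close> for
    x times \<open>e\<close>.\<close>
  have 2: "h * b \<preceq> pCons 0 (e * a)"
  proof (rule ratio_le_trans)
    show "h * b \<preceq> h * a"
      by (rule ratio_le_mult[OF h ab(1)])
    show "h * a \<preceq> pCons 0 (e * a)"
      using ratio_le_mult[OF a eh(2)] by (simp add: mult.commute)
  qed (use \<open>h \<noteq> 0\<close> \<open>a \<noteq> 0\<close> nn in \<open>auto intro!: nonneg_coeffs_intros\<close>)
  have "log_concave (e * a + h * b)"
    by (intro log_concave_add log_concave_mult e h a b 1 2)
  then show ?thesis
    using domination_poly_lollipop[OF m assms(2)] by (simp add: e_def h_def a_def b_def)
qed

theorem theorem4p3:
  fixes m n :: nat
  assumes "m > 0" and "n > 0"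
  shows "unimodal (domination_poly (lollipop m n))"
  using assms by (intro log_concave_imp_unimodal log_concave_domination_poly_lollipop)

end
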